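(* The minimal faithful permutation degree of the Coxeter group of type $H_3$ is $7$, that is, $\mu(W(H_3)) = 7$.
   Context: For a finite group $G$, $\mu(G)$ denotes the minimal faithful permutation degree of $G$: the least non-negative integer $m$ such that $G$ embeds in the symmetric group $\mathrm{Sym}(m)$. $W(H_3)$ denotes the finite irreducible Coxeter group of type $H_3$ (Coxeter diagram a path on $3$ vertices with consecutive edge labels $5,3$), of order $120$. *)

theory Defs
  imports "HOL-Algebra.Sym_Groups" "HOL-Library.Extended_Nat"
begin

definition min_perm_degree :: "('a, 'b) monoid_scheme \<Rightarrow> nat"
  where "min_perm_degree G =
    (LEAST m. \<exists>\<phi>. \<phi> \<in> mon G (sym_group m))"

text \<open>
  The group presented by generators \<open>S\<close> and relators \<open>R\<close>. A word is a list of letters,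
  where \<open>(s, True)\<close> stands for the generator \<open>s\<close> and \<open>(s, False)\<close> for its formal inverse.
\<close>

type_synonym 'a word = "('a \<times> bool) list"

definition words :: "'a set \<Rightarrow> 'a word set"
  where "words S = lists (S \<times> UNIV)"

inductive pres_eq :: "'a set \<Rightarrow> 'a word set \<Rightarrow> 'a word \<Rightarrow> 'a word \<Rightarrow> bool"
  for S :: "'a set" and R :: "'a word set"
  where
    refl: "u \<in> words S \<Longrightarrow> pres_eq S R u u"
  | sym: "pres_eq S R u v \<Longrightarrow> pres_eq S R v u"
  | trans: "pres_eq S R u v \<Longrightarrow> pres_eq S R v w \<Longrightarrow> pres_eq S R u w"
  | cancel: "u \<in> words S \<Longrightarrow> v \<in> words S \<Longrightarrow> s \<in> S \<Longrightarrow>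
      pres_eq S R (u @ [(s, e), (s, \<not> e)] @ v) (u @ v)"
  | relator: "u \<in> words S \<Longrightarrow> v \<in> words S \<Longrightarrow> r \<in> R \<Longrightarrow> r \<in> words S \<Longrightarrow>
      pres_eq S R (u @ r @ v) (u @ v)"

definition presented_group :: "'a set \<Rightarrow> 'a word set \<Rightarrow> 'a word set monoid"
  where "presented_group S R =
    \<lparr> carrier = words S // {(u, v). pres_eq S R u v},
      mult = (\<lambda>A B. {w. \<exists>u\<in>A. \<exists>v\<in>B. pres_eq S R (u @ v) w}),
      one = {w. pres_eq S R [] w} \<rparr>"

definition coxeter_matrix :: "'a set \<Rightarrow> ('a \<Rightarrow> 'a \<Rightarrow> enat) \<Rightarrow> bool"
  where "coxeter_matrix S M \<longleftrightarrow>
    (\<forall>s\<in>S. M s s = 1) \<and>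
    (\<forall>s\<in>S. \<forall>t\<in>S. M s t = M t s \<and> (s \<noteq> t \<longrightarrow> M s t \<ge> 2))"

text \<open>
  The relators are \<open>(s t)^M s t\<close> for finite \<open>M s t\<close>; those with \<open>s = t\<close> say that
  the generators are involutions.
\<close>

definition coxeter_relators :: "'a set \<Rightarrow> ('a \<Rightarrow> 'a \<Rightarrow> enat) \<Rightarrow> 'a word set"
  where "coxeter_relators S M =
    {concat (replicate m [(s, True), (t, True)]) | s t m. s \<in> S \<and> t \<in> S \<and> M s t = enat m}"

definition coxeter_group :: "'a set \<Rightarrow> ('a \<Rightarrow> 'a \<Rightarrow> enat) \<Rightarrow> 'a word set monoid"
  where "coxeter_group S M = presented_group S (coxeter_relators S M)"

definition H3_matrix :: "nat \<Rightarrow> nat \<Rightarrow> enat"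
  where "H3_matrix i j =
    (if i = j then 1
     else if {i, j} = {1, 2} then 5
     else if {i, j} = {2, 3} then 3
     else 2)"

definition W_H3 :: "nat word set monoid"
  where "W_H3 = coxeter_group {1, 2, 3} H3_matrix"

lemma coxeter_matrix_H3: "coxeter_matrix {1, 2, 3} H3_matrix"
proof -
  have "(2::enat) \<le> 5" "(2::enat) \<le> 3" by simp_all
  then show ?thesis
    by (auto simp: coxeter_matrix_def H3_matrix_def insert_commute)
qed

lemma words_append: "u \<in> words S \<Longrightarrow> v \<in> words S \<Longrightarrow> u @ v \<in> words S"
  by (auto simp: words_def)

lemma pres_eq_words: "pres_eq S R u v \<Longrightarrow> u \<in> words S \<and> v \<in> words S"
  by (induction rule: pres_eq.induct) (auto simp: words_def)

lemma pres_eq_append_left: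
  assumes "pres_eq S R u v" "w \<in> words S"
  shows "pres_eq S R (w @ u) (w @ v)"
  using assms(1)
proof (induction rule: pres_eq.induct)
  case (refl u)
  then show ?case using assms(2) by (intro pres_eq.refl words_append)
next
  case (cancel u v s e)
  then show ?case
    using pres_eq.cancel[of "w @ u" S v s R e] assms(2) by (simp add: words_append)
next
  case (relator u v r)
  then show ?case
    using pres_eq.relator[of "w @ u" S v r R] assms(2) by (simp add: words_append)
qed (blast intro: pres_eq.sym pres_eq.trans)+

lemma pres_eq_append_right:
  assumes "pres_eq S R u v" "w \<in> words S"
  shows "pres_eq S R (u @ w) (v @ w)"
  using assms(1)
proof (induction rule: pres_eq.induct)
  case (refl u)
  then show ?case using assms(2) by (intro pres_eq.refl words_append)
next
  case (cancel u v s e)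
  then show ?case
    using pres_eq.cancel[of u S "v @ w" s R e] assms(2) by (simp add: words_append)
next
  case (relator u v r)
  then show ?case
    using pres_eq.relator[of u S "v @ w" r R] assms(2) by (simp add: words_append)
qed (blast intro: pres_eq.sym pres_eq.trans)+

lemma pres_eq_append:
  "pres_eq S R u u' \<Longrightarrow> pres_eq S R v v' \<Longrightarrow> pres_eq S R (u @ v) (u' @ v')"
  by (meson pres_eq.trans pres_eq_append_left pres_eq_append_right pres_eq_words)

definition pres_class :: "'a set \<Rightarrow> 'a word set \<Rightarrow> 'a word \<Rightarrow> 'a word set"
  where "pres_class S R u = {w. pres_eq S R u w}"

lemma pres_class_eq_iff:
  "u \<in> words S \<Longrightarrow> pres_class S R u = pres_class S R v \<longleftrightarrow> pres_eq S R u v"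
  unfolding pres_class_def
  by (auto intro: pres_eq.refl pres_eq.sym pres_eq.trans)

lemma carrier_presented_group: "carrier (presented_group S R) = pres_class S R ` words S"
  by (auto simp: presented_group_def quotient_def pres_class_def)

lemma one_presented_group: "\<one>\<^bsub>presented_group S R\<^esub> = pres_class S R []"
  by (simp add: presented_group_def pres_class_def)

lemma mult_presented_group:
  assumes "u \<in> words S" "v \<in> words S"
  shows "pres_class S R u \<otimes>\<^bsub>presented_group S R\<^esub> pres_class S R v = pres_class S R (u @ v)"
  using assms unfolding presented_group_def pres_class_def
  by (auto intro: pres_eq.refl pres_eq.trans pres_eq_append)

lemma pres_eq_inverse:
  assumes "u \<in> words S"
  shows "\<exists>v\<in>words S. pres_eq S R (v @ u) []"
  using assms
proof (induction u)
  case Nil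
  then show ?case by (intro bexI[of _ "[]"]) (auto simp: words_def intro: pres_eq.refl)
next
  case (Cons a u)
  obtain s e where a: "a = (s, e)" by force
  have s: "s \<in> S" and u: "u \<in> words S" using Cons.prems a by (auto simp: words_def)
  obtain v where v: "v \<in> words S" "pres_eq S R (v @ u) []" using Cons.IH u by blast
  have "pres_eq S R (v @ [(s, \<not> e), (s, e)] @ u) (v @ u)"
    using pres_eq.cancel[OF v(1) u s, of R "\<not> e"] by simp
  then have "pres_eq S R ((v @ [(s, \<not> e)]) @ a # u) []"
    using v(2) a by (auto intro: pres_eq.trans)
  moreover have "v @ [(s, \<not> e)] \<in> words S" using v(1) s by (auto simp: words_def)
  ultimately show ?case by blast
qed

lemma group_presented_group: "group (presented_group S R)"
proof (rule groupI)
  show "\<one>\<^bsub>presented_group S R\<^esub> \<in> carrier (presented_group S R)"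
    by (auto simp: one_presented_group carrier_presented_group words_def)
next
  fix x assume "x \<in> carrier (presented_group S R)"
  then obtain u where u: "u \<in> words S" "x = pres_class S R u"
    by (auto simp: carrier_presented_group)
  then show "\<one>\<^bsub>presented_group S R\<^esub> \<otimes>\<^bsub>presented_group S R\<^esub> x = x"
    using mult_presented_group[of "[]" S u R] by (simp add: one_presented_group words_def)
  obtain v where v: "v \<in> words S" "pres_eq S R (v @ u) []" using pres_eq_inverse u(1) by blast
  then have "pres_class S R v \<otimes>\<^bsub>presented_group S R\<^esub> x = \<one>\<^bsub>presented_group S R\<^esub>"
    using u by (simp add: mult_presented_group one_presented_group pres_class_eq_iff words_append)
  then show "\<exists>y\<in>carrier (presented_group S R).
      y \<otimes>\<^bsub>presented_group S R\<^esub> x = \<one>\<^bsub>presented_group S R\<^esub>"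
    using v(1) by (auto simp: carrier_presented_group)
qed (auto simp: carrier_presented_group mult_presented_group words_append)

end

theory Submission
  imports Defs "HOL-Computational_Algebra.Primes"
begin

text \<open>
  The group \<open>W(H\<^sub>3)\<close> is the direct product of the alternating group on five points with a group
  of order two, so that it acts faithfully on \<open>5 + 2 = 7\<close> points. Every simple reflection acts as a
  product of two transpositions on the five points and exchanges the other two.

  The presentation gives this action at once, but its faithfulness needs an upper bound on the
  group defined by the presentation. The bound is a coset enumeration: the words in the reflections
  \<open>1\<close> and \<open>2\<close> reduce to ten alternating words (lemma \<open>dihedral_closed\<close>), and the cosets of the
  dihedral subgroup that they represent have twelve explicit representatives, corresponding to the
  twelve vertices of the icosahedron (lemma \<open>coset_graph_sound\<close>). Hence every element is one of 120
  explicit products, and among these only the empty word acts trivially on the seven points, which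
  is a finite computation.

  No smaller degree is possible because of the Coxeter element \<open>s\<^sub>1 s\<^sub>2 s\<^sub>3\<close>, which has order
  \<open>10 = 2 \<cdot> 5\<close>: a permutation of order \<open>a b\<close>, for distinct primes \<open>a\<close> and \<open>b\<close>, moves at least
  \<open>a + b\<close> points (lemma \<open>funpow_prime_mult_eq_id\<close>). The order of the Coxeter element is read
  off from the faithful action on seven points and not from the relations.
\<close>

section \<open>Permutations of order a product of two primes\<close>

text \<open>
  If neither power is trivial, then some cycle has length divisible by \<open>a\<close> and some cycle has
  length divisible by \<open>b\<close>. Together these two cycles, or the single cycle if they coincide, contain
  at least \<open>a + b\<close> points.
\<close>

lemma funpow_prime_mult_eq_id:
  fixes p :: "'a \<Rightarrow> 'a" and a b :: nat
  assumes "p permutes A" "finite A" "card A < a + b"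
    and "normalization_semidom_class.prime a" "normalization_semidom_class.prime b"
    and "a \<noteq> b" "p ^^ (a * b) = id"
  shows "p ^^ a = id \<or> p ^^ b = id"
proof (rule ccontr)
  assume "\<not> ?thesis"
  then obtain x y where x: "(p ^^ b) x \<noteq> x" and y: "(p ^^ a) y \<noteq> y"
    by (auto simp: fun_eq_iff)
  have perm: "permutation p"
    using assms(1,2) by (auto simp: permutation_permutes)
  have dvd: "least_power p z dvd a * b" for z
    by (simp add: least_power_dvd[OF perm] assms(7))
  have a: "a dvd least_power p x"
  proof (rule ccontr)
    assume "\<not> a dvd least_power p x"
    then have "coprime (least_power p x) a"
      using assms(4) prime_imp_coprime coprime_commute by blast
    then show False
      using dvd[of x] x least_power_dvd[OF perm] coprime_dvd_mult_right_iff by blast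
  qed
  have b: "b dvd least_power p y"
  proof (rule ccontr)
    assume "\<not> b dvd least_power p y"
    then have "coprime (least_power p y) b"
      using assms(5) prime_imp_coprime coprime_commute by blast
    then show False
      using dvd[of y] y least_power_dvd[OF perm] coprime_dvd_mult_left_iff by blast
  qed
  have card: "card (set (support p z)) = least_power p z" for z
    using distinct_card[OF cycle_of_permutation[OF perm, of z]] by (simp only: length_map length_upt)
  have pos: "least_power p z > 0" for z
    using least_power_of_permutation[OF perm] by blast
  have sub: "set (support p z) \<subseteq> A" if "z \<in> A" for z
    using that by (auto simp: permutes_in_image[OF permutes_funpow[OF assms(1)]])
  have xA: "x \<in> A" and yA: "y \<in> A"
    using x y permutes_not_in[OF permutes_funpow[OF assms(1)]] by metis+
  consider "set (support p x) = set (support p y)" | "set (support p x) \<inter> set (support p y) = {}"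
    using disjointD[OF disjoint_support[OF perm] rangeI rangeI] by blast
  then show False
  proof cases
    case 1
    then have "b dvd least_power p x"
      using b card[of x] card[of y] by simp
    then have "a * b dvd least_power p x"
      using a divides_mult primes_coprime[OF assms(4,5,6)] by blast
    then have "a * b \<le> card A"
      using dvd_imp_le[OF _ pos[of x]] card_mono[OF assms(2) sub[OF xA]] unfolding card by fastforce
    moreover have "a + b \<le> a * b"
    proof -
      have "2 \<le> a" "2 \<le> b"
        using assms(4,5) prime_ge_2_nat by blast+
      then obtain i j where "a = 2 + i" "b = 2 + j"
        using le_Suc_ex by blast
      then show ?thesis by simp
    qed
    ultimately show False using assms(3) by simp
  next
    case 2
    then have "least_power p x + least_power p y \<le> card A"
      using card_Un_disjoint[OF _ _ 2] card_mono[OF assms(2) Un_least[OF sub[OF xA] sub[OF yA]]]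
      unfolding card by simp
    moreover have "a \<le> least_power p x" "b \<le> least_power p y"
      using a b pos dvd_imp_le by blast+
    ultimately show False using assms(3) by simp
  qed
qed

lemma sym_group_pow: "p [^]\<^bsub>sym_group m\<^esub> (n::nat) = p ^^ n"
  by (induction n) (auto simp: nat_pow_def sym_group_def funpow_swap1 fun_eq_iff)

section \<open>Homomorphisms from presented groups\<close>

definition word_eval :: "('b, 'c) monoid_scheme \<Rightarrow> ('a \<Rightarrow> 'b) \<Rightarrow> 'a word \<Rightarrow> 'b"
  where "word_eval G f w =
    foldr (\<lambda>(s, e) x. (if e then f s else inv\<^bsub>G\<^esub> f s) \<otimes>\<^bsub>G\<^esub> x) w \<one>\<^bsub>G\<^esub>"

context group
begin

lemma word_eval_closed:
  "f \<in> S \<rightarrow> carrier G \<Longrightarrow> w \<in> words S \<Longrightarrow> word_eval G f w \<in> carrier G"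
  by (induction w) (auto simp: word_eval_def words_def Pi_iff)

lemma word_eval_append:
  "f \<in> S \<rightarrow> carrier G \<Longrightarrow> u \<in> words S \<Longrightarrow> v \<in> words S \<Longrightarrow>
    word_eval G f (u @ v) = word_eval G f u \<otimes> word_eval G f v"
proof (induction u)
  case Nil
  then show ?case using word_eval_closed[OF Nil(1,3)] by (simp add: word_eval_def)
next
  case (Cons l u)
  obtain s e where l: "l = (s, e)" by force
  have "s \<in> S" "u \<in> words S" using Cons.prems l by (auto simp: words_def)
  moreover have "word_eval G f (l # w) = (if e then f s else inv f s) \<otimes> word_eval G f w" for w
    by (simp add: word_eval_def l)
  ultimately show ?case
    using Cons word_eval_closed[of f S] by (auto simp: m_assoc Pi_iff)
qed

lemma word_eval_pres_eq:
  assumes f: "f \<in> S \<rightarrow> carrier G"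
    and R: "\<And>r. r \<in> R \<Longrightarrow> r \<in> words S \<Longrightarrow> word_eval G f r = \<one>"
    and "pres_eq S R u v"
  shows "word_eval G f u = word_eval G f v"
  using assms(3)
proof (induction rule: pres_eq.induct)
  case (cancel u v s e)
  then have "[(s, e), (s, \<not> e)] \<in> words S" by (simp add: words_def)
  moreover have "word_eval G f [(s, e), (s, \<not> e)] = \<one>"
    using f cancel by (auto simp: word_eval_def Pi_iff)
  ultimately show ?case
    using cancel f by (simp add: word_eval_append words_append word_eval_closed del: append_Cons)
next
  case (relator u v r)
  then show ?case
    using R[of r] f by (simp add: word_eval_append words_append word_eval_closed)
qed auto

text \<open>The universal property of a presentation.\<close>

lemma presented_group_hom:
  assumes f: "f \<in> S \<rightarrow> carrier G"
    and R: "\<And>r. r \<in> R \<Longrightarrow> r \<in> words S \<Longrightarrow> word_eval G f r = \<one>"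
  obtains \<psi> where "\<psi> \<in> hom (presented_group S R) G"
    and "\<And>w. w \<in> words S \<Longrightarrow> \<psi> (pres_class S R w) = word_eval G f w"
proof
  define \<psi> where "\<psi> A = word_eval G f (SOME w. w \<in> A)" for A
  show eval: "\<psi> (pres_class S R w) = word_eval G f w" if "w \<in> words S" for w
  proof -
    have "w \<in> pres_class S R w"
      using that by (simp add: pres_class_def pres_eq.refl)
    then have "(SOME v. v \<in> pres_class S R w) \<in> pres_class S R w"
      by (rule someI)
    then show ?thesis
      using word_eval_pres_eq[OF f R] by (auto simp: \<psi>_def pres_class_def)
  qed
  show "\<psi> \<in> hom (presented_group S R) G"
    using f by (auto simp: hom_def carrier_presented_group mult_presented_group eval
        word_eval_append words_append word_eval_closed)
qed

end

section \<open>Coset enumeration\<close>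

text \<open>
  Since the generators are involutions, words without inverse letters suffice. A word with a letter
  other than \<open>1\<close>, \<open>2\<close>, \<open>3\<close> is sent to the empty set, so that the rewriting rules below
  hold for all lists without side conditions on the letters.
\<close>

definition H3_elem :: "nat list \<Rightarrow> nat word set"
  where "H3_elem w =
    pres_class {1, 2, 3} (coxeter_relators {1, 2, 3} H3_matrix) (map (\<lambda>s. (s, True)) w)"

lemma H3_elem_eqI:
  assumes "set u \<subseteq> {1, 2, 3} \<longleftrightarrow> set v \<subseteq> {1, 2, 3}"
    and "set u \<subseteq> {1, 2, 3} \<Longrightarrow>
      pres_eq {1, 2, 3} (coxeter_relators {1, 2, 3} H3_matrix)
        (map (\<lambda>s. (s, True)) u) (map (\<lambda>s. (s, True)) v)"
  shows "H3_elem u = H3_elem v"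
proof (cases "set u \<subseteq> {1, 2, 3}")
  case True
  then show ?thesis
    unfolding H3_elem_def by (subst pres_class_eq_iff) (use assms in \<open>auto simp: words_def\<close>)
next
  case False
  have "H3_elem w = {}" if "\<not> set w \<subseteq> {1, 2, 3}" for w
  proof -
    have "map (\<lambda>s. (s, True)) w \<notin> words {1, 2, 3}" using that by (auto simp: words_def)
    then show ?thesis by (auto simp: H3_elem_def pres_class_def dest: pres_eq_words)
  qed
  then show ?thesis using False assms(1) by metis
qed

lemma H3_elem_eqD:
  assumes "H3_elem u = H3_elem v" "set u \<subseteq> {1, 2, 3}"
  shows "pres_eq {1, 2, 3} (coxeter_relators {1, 2, 3} H3_matrix)
        (map (\<lambda>s. (s, True)) u) (map (\<lambda>s. (s, True)) v)"
  using assms unfolding H3_elem_def by (subst (asm) pres_class_eq_iff) (auto simp: words_def)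

lemma H3_elem_eq_letters:
  assumes "H3_elem u = H3_elem v"
  shows "set u \<subseteq> {1, 2, 3} \<longleftrightarrow> set v \<subseteq> {1, 2, 3}"
proof -
  have "set v \<subseteq> {1, 2, 3}" if "H3_elem u = H3_elem v" "set u \<subseteq> {1, 2, 3}" for u v
    using pres_eq_words[OF H3_elem_eqD[OF that]] by (auto simp: words_def)
  then show ?thesis using assms by metis
qed

lemma H3_elem_Cons: "H3_elem u = H3_elem v \<Longrightarrow> H3_elem (s # u) = H3_elem (s # v)"
  using H3_elem_eq_letters[of u v] pres_eq_append_left[OF H3_elem_eqD[of u v], of "[(s, True)]"]
  by (intro H3_elem_eqI) (auto simp: words_def)

lemma H3_elem_append: "H3_elem u = H3_elem v \<Longrightarrow> H3_elem (w @ u) = H3_elem (w @ v)"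
proof (induction w)
  case (Cons s w)
  then show ?case using H3_elem_Cons[of "w @ u" "w @ v" s] by simp
qed simp

lemma H3_elem_relator:
  assumes "s \<in> {1, 2, 3}" "t \<in> {1, 2, 3}" "H3_matrix s t = enat m"
  shows "H3_elem (concat (replicate m [s, t]) @ u) = H3_elem u"
proof (rule H3_elem_eqI)
  let ?r = "concat (replicate m [s, t])"
  have r: "set ?r \<subseteq> {1, 2, 3}"
    using assms(1,2) by auto
  then show "set (?r @ u) \<subseteq> {1, 2, 3} \<longleftrightarrow> set u \<subseteq> {1, 2, 3}"
    by simp
  assume "set (?r @ u) \<subseteq> {1, 2, 3}"
  then have u: "map (\<lambda>s. (s, True)) u \<in> words {1, 2, 3}"
    by (auto simp: words_def)
  have map_r: "map (\<lambda>s. (s, True)) ?r = concat (replicate m [(s, True), (t, True)])"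
    by (simp add: map_concat)
  have "map (\<lambda>s. (s, True)) ?r \<in> words {1, 2, 3}"
    using r unfolding words_def by fastforce
  moreover have "map (\<lambda>s. (s, True)) ?r \<in> coxeter_relators {1, 2, 3} H3_matrix"
    unfolding map_r coxeter_relators_def using assms by blast
  moreover have "[] \<in> words {1, 2, 3}"
    by (simp add: words_def)
  ultimately have "pres_eq {1, 2, 3} (coxeter_relators {1, 2, 3} H3_matrix)
      ([] @ map (\<lambda>s. (s, True)) ?r @ map (\<lambda>s. (s, True)) u) ([] @ map (\<lambda>s. (s, True)) u)"
    using u by (intro pres_eq.relator)
  then show "pres_eq {1, 2, 3} (coxeter_relators {1, 2, 3} H3_matrix)
      (map (\<lambda>s. (s, True)) (?r @ u)) (map (\<lambda>s. (s, True)) u)"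
    by (simp only: map_append append_Nil)
qed

lemma H3_elem_square: "s \<in> {1, 2, 3} \<Longrightarrow> H3_elem (s # s # u) = H3_elem u"
  using H3_elem_relator[of s s 1 u] by (simp add: H3_matrix_def one_enat_def)

lemma H3_elem_rev_cancel:
  "set w \<subseteq> {1, 2, 3} \<Longrightarrow> H3_elem (rev w @ w @ u) = H3_elem u"
proof (induction w)
  case (Cons s w)
  have "H3_elem (rev (s # w) @ (s # w) @ u) = H3_elem (rev w @ w @ u)"
    using Cons.prems H3_elem_append[OF H3_elem_square, of s] by simp
  then show ?case using Cons by simp
qed simp

text \<open>
  A relator split into two halves is a braid move, because the reversal of a word in involutions
  represents its inverse.
\<close>

lemma H3_elem_braid:
  assumes "s \<in> {1, 2, 3}" "t \<in> {1, 2, 3}" "H3_matrix s t = enat m"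
    and r: "concat (replicate m [s, t]) = v @ rev w"
  shows "H3_elem (w @ u) = H3_elem (v @ u)"
proof -
  have "set (v @ rev w) \<subseteq> {1, 2, 3}"
    unfolding r[symmetric] using assms(1,2) by auto
  then have w: "set w \<subseteq> {1, 2, 3}" by simp
  have "H3_elem (w @ u) = H3_elem (v @ rev w @ w @ u)"
    using H3_elem_relator[OF assms(1-3), of "w @ u"] unfolding r by simp
  also have "\<dots> = H3_elem (v @ u)"
    by (intro H3_elem_append H3_elem_rev_cancel w)
  finally show ?thesis .
qed

lemma H3_elem_commute: "H3_elem (3 # 1 # u) = H3_elem (1 # 3 # u)"
proof -
  have "H3_matrix 1 3 = enat 2"
    by (simp add: H3_matrix_def numeral_eq_enat doubleton_eq_iff)
  moreover have "concat (replicate 2 [1::nat, 3]) = [1, 3] @ rev [3, 1]"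
    by code_simp
  ultimately show ?thesis
    using H3_elem_braid[of 1 3 2 "[1, 3]" "[3, 1]" u] by simp
qed

lemma H3_elem_braid23: "H3_elem (3 # 2 # 3 # u) = H3_elem (2 # 3 # 2 # u)"
proof -
  have "H3_matrix 2 3 = enat 3"
    by (simp add: H3_matrix_def numeral_eq_enat doubleton_eq_iff)
  moreover have "concat (replicate 3 [2::nat, 3]) = [2, 3, 2] @ rev [3, 2, 3]"
    by code_simp
  ultimately show ?thesis
    using H3_elem_braid[of 2 3 3 "[2, 3, 2]" "[3, 2, 3]" u] by simp
qed

lemma H3_elem_braid12: "H3_elem (2 # 1 # 2 # 1 # 2 # u) = H3_elem (1 # 2 # 1 # 2 # 1 # u)"
proof -
  have "H3_matrix 1 2 = enat 5"
    by (simp add: H3_matrix_def numeral_eq_enat doubleton_eq_iff)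
  moreover have "concat (replicate 5 [1::nat, 2]) = [1, 2, 1, 2, 1] @ rev [2, 1, 2, 1, 2]"
    by code_simp
  ultimately show ?thesis
    using H3_elem_braid[of 1 2 5 "[1, 2, 1, 2, 1]" "[2, 1, 2, 1, 2]" u] by simp
qed

definition dihedral_words :: "nat list list"
  where "dihedral_words =
    [[], [1], [2], [1, 2], [2, 1], [1, 2, 1], [2, 1, 2], [1, 2, 1, 2], [2, 1, 2, 1],
     [1, 2, 1, 2, 1]]"

definition coset_words :: "nat list list"
  where "coset_words =
    [[], [3], [2, 3], [1, 2, 3], [2, 1, 2, 3], [1, 2, 1, 2, 3], [3, 2, 1, 2, 3],
     [1, 3, 2, 1, 2, 3], [2, 1, 3, 2, 1, 2, 3], [1, 2, 1, 3, 2, 1, 2, 3],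
     [2, 1, 2, 1, 3, 2, 1, 2, 3], [3, 2, 1, 2, 1, 3, 2, 1, 2, 3]]"

lemma dihedral_closed:
  assumes "s \<in> {1, 2}" "d \<in> set dihedral_words"
  shows "\<exists>d'\<in>set dihedral_words. H3_elem (s # d) = H3_elem d'"
proof -
  have "H3_elem [2, 1, 2, 1, 2] = H3_elem [1, 2, 1, 2, 1]"
    by (rule H3_elem_braid12)
  moreover have "H3_elem [2, 1, 2, 1, 2, 1] = H3_elem [1, 2, 1, 2]"
  proof -
    have "H3_elem [2, 1, 2, 1, 2, 1] = H3_elem [1, 2, 1, 2, 1, 1]"
      by (rule H3_elem_braid12)
    also have "\<dots> = H3_elem [1, 2, 1, 2]"
      by (intro H3_elem_Cons H3_elem_square) simp
    finally show ?thesis .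
  qed
  ultimately have "\<forall>s\<in>{1, 2}. \<forall>d\<in>set dihedral_words.
      H3_elem (s # d) \<in> H3_elem ` set dihedral_words"
    by (simp add: dihedral_words_def H3_elem_square del: One_nat_def)
  then show ?thesis using assms by (simp only: Bex_def image_iff)
qed

text \<open>
  Left multiplication by a reflection moves a representative to another one or, by Deodhar's lemma,
  has the effect of inserting a reflection \<open>1\<close> or \<open>2\<close> after the representative. The second case
  occurs when the reflection fixes the corresponding vertex of the icosahedron. The identities below
  are those of the second kind that take more than one braid move. The ones for long
  representatives reduce to those for shorter ones by braid moves at the front of the word.
\<close>

lemma coset_fixed:
  "H3_elem (3 # 1 # 2 # 3 # u) = H3_elem (1 # 2 # 3 # 2 # u)" (is ?A)
  "H3_elem (2 # 1 # 2 # 1 # 2 # 3 # u) = H3_elem (1 # 2 # 1 # 2 # 3 # 1 # u)" (is ?B)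
  "H3_elem (2 # 3 # 2 # 1 # 2 # 3 # u) = H3_elem (3 # 2 # 1 # 2 # 3 # 2 # u)" (is ?C)
  "H3_elem (3 # 2 # 1 # 3 # 2 # 1 # 2 # 3 # u) =
    H3_elem (2 # 1 # 3 # 2 # 1 # 2 # 3 # 1 # u)" (is ?D)
  "H3_elem (3 # 1 # 2 # 1 # 3 # 2 # 1 # 2 # 3 # u) =
    H3_elem (1 # 2 # 1 # 3 # 2 # 1 # 2 # 3 # 1 # u)" (is ?E)
  "H3_elem (1 # 2 # 1 # 2 # 1 # 3 # 2 # 1 # 2 # 3 # u) =
    H3_elem (2 # 1 # 2 # 1 # 3 # 2 # 1 # 2 # 3 # 2 # u)" (is ?F)
  "H3_elem (1 # 3 # 2 # 1 # 2 # 1 # 3 # 2 # 1 # 2 # 3 # u) =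
    H3_elem (3 # 2 # 1 # 2 # 1 # 3 # 2 # 1 # 2 # 3 # 2 # u)" (is ?G)
  "H3_elem (2 # 3 # 2 # 1 # 2 # 1 # 3 # 2 # 1 # 2 # 3 # u) =
    H3_elem (3 # 2 # 1 # 2 # 1 # 3 # 2 # 1 # 2 # 3 # 1 # u)" (is ?H)
proof -
  note moves = H3_elem_Cons H3_elem_commute H3_elem_commute[symmetric]
    H3_elem_braid23 H3_elem_braid23[symmetric] H3_elem_braid12 H3_elem_braid12[symmetric]
  have "H3_elem (3 # 1 # 2 # 3 # u) = H3_elem (1 # 3 # 2 # 3 # u)" by (intro moves)
  also have "\<dots> = H3_elem (1 # 2 # 3 # 2 # u)" by (intro moves)
  finally show ?A .
  have "H3_elem (2 # 1 # 2 # 1 # 2 # 3 # u) = H3_elem (1 # 2 # 1 # 2 # 1 # 3 # u)" by (intro moves)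
  also have "\<dots> = H3_elem (1 # 2 # 1 # 2 # 3 # 1 # u)" by (intro moves)
  finally show B: ?B .
  have C: "H3_elem (2 # 3 # 2 # 1 # 2 # 3 # u) = H3_elem (3 # 2 # 1 # 2 # 3 # 2 # u)" for u
  proof -
    have "H3_elem (2 # 3 # 2 # 1 # 2 # 3 # u) = H3_elem (3 # 2 # 3 # 1 # 2 # 3 # u)"
      by (intro moves)
    also have "\<dots> = H3_elem (3 # 2 # 1 # 3 # 2 # 3 # u)" by (intro moves)
    also have "\<dots> = H3_elem (3 # 2 # 1 # 2 # 3 # 2 # u)" by (intro moves)
    finally show ?thesis .
  qed
  then show ?C .
  have "H3_elem (3 # 2 # 1 # 3 # 2 # 1 # 2 # 3 # u) =
      H3_elem (3 # 2 # 3 # 1 # 2 # 1 # 2 # 3 # u)" by (intro moves)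
  also have "\<dots> = H3_elem (2 # 3 # 2 # 1 # 2 # 1 # 2 # 3 # u)" by (intro moves)
  also have "\<dots> = H3_elem (2 # 3 # 1 # 2 # 1 # 2 # 3 # 1 # u)" by (intro B H3_elem_Cons)
  also have "\<dots> = H3_elem (2 # 1 # 3 # 2 # 1 # 2 # 3 # 1 # u)" by (intro moves)
  finally show D: ?D .
  have "H3_elem (3 # 1 # 2 # 1 # 3 # 2 # 1 # 2 # 3 # u) =
      H3_elem (1 # 3 # 2 # 1 # 3 # 2 # 1 # 2 # 3 # u)" by (intro moves)
  also have "\<dots> = H3_elem (1 # 2 # 1 # 3 # 2 # 1 # 2 # 3 # 1 # u)" by (intro D H3_elem_Cons)
  finally show E: ?E .
  have "H3_elem (1 # 2 # 1 # 2 # 1 # 3 # 2 # 1 # 2 # 3 # u) =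
      H3_elem (2 # 1 # 2 # 1 # 2 # 3 # 2 # 1 # 2 # 3 # u)" by (intro moves)
  also have "\<dots> = H3_elem (2 # 1 # 2 # 1 # 3 # 2 # 1 # 2 # 3 # 2 # u)"
    by (intro C H3_elem_Cons)
  finally show F: ?F .
  have "H3_elem (1 # 3 # 2 # 1 # 2 # 1 # 3 # 2 # 1 # 2 # 3 # u) =
      H3_elem (3 # 1 # 2 # 1 # 2 # 1 # 3 # 2 # 1 # 2 # 3 # u)" by (intro moves)
  also have "\<dots> = H3_elem (3 # 2 # 1 # 2 # 1 # 3 # 2 # 1 # 2 # 3 # 2 # u)"
    by (intro F H3_elem_Cons)
  finally show ?G .
  have "H3_elem (2 # 3 # 2 # 1 # 2 # 1 # 3 # 2 # 1 # 2 # 3 # u) =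
      H3_elem (3 # 2 # 3 # 1 # 2 # 1 # 3 # 2 # 1 # 2 # 3 # u)" by (intro moves)
  also have "\<dots> = H3_elem (3 # 2 # 1 # 2 # 1 # 3 # 2 # 1 # 2 # 3 # 1 # u)"
    by (intro E H3_elem_Cons)
  finally show ?H .
qed

text \<open>
  An entry \<open>(s, t, t', e)\<close> records the relation \<open>s t = t' e\<close>. Without \<open>e\<close> this is the action of
  the simple reflections on the vertices of the icosahedron.
\<close>

definition coset_graph :: "(nat \<times> nat list \<times> nat list \<times> nat list) list"
  where "coset_graph =
    [(1, [], [], [1]),
     (2, [], [], [2]),
     (3, [], [3], []),
     (1, [3], [3], [1]),
     (2, [3], [2, 3], []),
     (3, [3], [], []),
     (1, [2, 3], [1, 2, 3], []),
     (2, [2, 3], [3], []),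
     (3, [2, 3], [2, 3], [2]),
     (1, [1, 2, 3], [2, 3], []),
     (2, [1, 2, 3], [2, 1, 2, 3], []),
     (3, [1, 2, 3], [1, 2, 3], [2]),
     (1, [2, 1, 2, 3], [1, 2, 1, 2, 3], []),
     (2, [2, 1, 2, 3], [1, 2, 3], []),
     (3, [2, 1, 2, 3], [3, 2, 1, 2, 3], []),
     (1, [1, 2, 1, 2, 3], [2, 1, 2, 3], []),
     (2, [1, 2, 1, 2, 3], [1, 2, 1, 2, 3], [1]),
     (3, [1, 2, 1, 2, 3], [1, 3, 2, 1, 2, 3], []),
     (1, [3, 2, 1, 2, 3], [1, 3, 2, 1, 2, 3], []),
     (2, [3, 2, 1, 2, 3], [3, 2, 1, 2, 3], [2]),
     (3, [3, 2, 1, 2, 3], [2, 1, 2, 3], []),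
     (1, [1, 3, 2, 1, 2, 3], [3, 2, 1, 2, 3], []),
     (2, [1, 3, 2, 1, 2, 3], [2, 1, 3, 2, 1, 2, 3], []),
     (3, [1, 3, 2, 1, 2, 3], [1, 2, 1, 2, 3], []),
     (1, [2, 1, 3, 2, 1, 2, 3], [1, 2, 1, 3, 2, 1, 2, 3], []),
     (2, [2, 1, 3, 2, 1, 2, 3], [1, 3, 2, 1, 2, 3], []),
     (3, [2, 1, 3, 2, 1, 2, 3], [2, 1, 3, 2, 1, 2, 3], [1]),
     (1, [1, 2, 1, 3, 2, 1, 2, 3], [2, 1, 3, 2, 1, 2, 3], []),
     (2, [1, 2, 1, 3, 2, 1, 2, 3], [2, 1, 2, 1, 3, 2, 1, 2, 3], []),
     (3, [1, 2, 1, 3, 2, 1, 2, 3], [1, 2, 1, 3, 2, 1, 2, 3], [1]),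
     (1, [2, 1, 2, 1, 3, 2, 1, 2, 3], [2, 1, 2, 1, 3, 2, 1, 2, 3], [2]),
     (2, [2, 1, 2, 1, 3, 2, 1, 2, 3], [1, 2, 1, 3, 2, 1, 2, 3], []),
     (3, [2, 1, 2, 1, 3, 2, 1, 2, 3], [3, 2, 1, 2, 1, 3, 2, 1, 2, 3], []),
     (1, [3, 2, 1, 2, 1, 3, 2, 1, 2, 3], [3, 2, 1, 2, 1, 3, 2, 1, 2, 3], [2]),
     (2, [3, 2, 1, 2, 1, 3, 2, 1, 2, 3], [3, 2, 1, 2, 1, 3, 2, 1, 2, 3], [1]),
     (3, [3, 2, 1, 2, 1, 3, 2, 1, 2, 3], [2, 1, 2, 1, 3, 2, 1, 2, 3], [])]"

lemma coset_graph_sound: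
  assumes "(s, t, t', e) \<in> set coset_graph"
  shows "H3_elem (s # t @ u) = H3_elem (t' @ e @ u)"
proof -
  have *: "H3_elem (3 # 1 # 2 # 1 # 2 # 3 # u) = H3_elem (1 # 3 # 2 # 1 # 2 # 3 # u)"
    by (rule H3_elem_commute)
  have **: "H3_elem (3 # 1 # 3 # 2 # 1 # 2 # 3 # u) = H3_elem (1 # 2 # 1 # 2 # 3 # u)"
    using H3_elem_commute[of "3 # 2 # 1 # 2 # 3 # u"]
      H3_elem_Cons[OF H3_elem_square[of 3 "2 # 1 # 2 # 3 # u"], of 1] by simp
  (* The commutation is used only for the entry with representative [3]: restricting it to the
     tail u keeps it from rewriting the left-hand sides of coset_fixed. The letter 1 has to keep its
     form for the rules to match. *)
  have "\<forall>(s, t, t', e)\<in>set coset_graph. H3_elem (s # t @ u) = H3_elem (t' @ e @ u)"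
    by (simp add: coset_graph_def H3_elem_square H3_elem_braid23 coset_fixed * **
        H3_elem_commute[of u] del: One_nat_def)
  then show ?thesis using assms by blast
qed

lemma coset_table:
  assumes "s \<in> {1, 2, 3}" "t \<in> set coset_words"
  shows "\<exists>t'\<in>set coset_words. \<exists>e\<in>{[], [1], [2]}. (s, t, t', e) \<in> set coset_graph"
proof -
  have "\<forall>s\<in>set [1, 2, 3]. \<forall>t\<in>set coset_words. \<exists>t'\<in>set coset_words. \<exists>e\<in>set [[], [1], [2]].
      (s, t, t', e) \<in> set coset_graph"
    by code_simp
  then show ?thesis using assms by (simp only: list.set)
qed

lemma H3_normal_form:
  assumes "set w \<subseteq> {1, 2, 3}"
  shows "\<exists>t\<in>set coset_words. \<exists>d\<in>set dihedral_words. H3_elem w = H3_elem (t @ d)"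
  using assms
proof (induction w)
  case Nil
  have "[] \<in> set coset_words" "[] \<in> set dihedral_words"
    by (simp_all add: coset_words_def dihedral_words_def)
  then show ?case by force
next
  case (Cons s w)
  then obtain t d where td: "t \<in> set coset_words" "d \<in> set dihedral_words"
    "H3_elem w = H3_elem (t @ d)"
    by auto
  have "s \<in> {1, 2, 3}" using Cons.prems by simp
  then obtain t' e where t': "t' \<in> set coset_words" "e \<in> {[], [1], [2]}"
    "(s, t, t', e) \<in> set coset_graph"
    using coset_table[OF _ td(1)] by blast
  have "\<exists>d'\<in>set dihedral_words. H3_elem (e @ d) = H3_elem d'"
    using t'(2) td(2) dihedral_closed[of _ d] by auto
  then show ?case
    using t'(1) H3_elem_append H3_elem_Cons[OF td(3)] coset_graph_sound[OF t'(3)] by metis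
qed

section \<open>The action on seven points\<close>

text \<open>
  The products of two transpositions on \<open>{1..5}\<close> alone satisfy the relations. The four
  transpositions for \<open>1\<close> and \<open>2\<close> form a path through all five points, so that their product is a
  5-cycle; the involutions for \<open>1\<close> and \<open>3\<close> lie in a Klein four-group; those for \<open>2\<close> and \<open>3\<close>
  share a transposition, so that their product is a 3-cycle. All relators have even length, and
  hence the relations persist with the common factor that exchanges \<open>6\<close> and \<open>7\<close>. This factor
  detects the central involution \<open>(s\<^sub>1 s\<^sub>2 s\<^sub>3)\<^sup>5\<close>, which acts trivially on \<open>{1..5}\<close>.
\<close>

definition H3_perm :: "nat \<Rightarrow> nat \<Rightarrow> nat"
  where "H3_perm s = transpose 6 7 \<circ>
    (if s = 1 then transpose 1 2 \<circ> transpose 3 4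
     else if s = 2 then transpose 2 3 \<circ> transpose 4 5
     else transpose 1 4 \<circ> transpose 2 3)"

lemma H3_perm_values:
  "H3_perm 1 1 = 2" "H3_perm 1 2 = 1" "H3_perm 1 3 = 4" "H3_perm 1 4 = 3"
    "H3_perm 1 5 = 5" "H3_perm 1 6 = 7" "H3_perm 1 7 = 6"
  "H3_perm 2 1 = 1" "H3_perm 2 2 = 3" "H3_perm 2 3 = 2" "H3_perm 2 4 = 5"
    "H3_perm 2 5 = 4" "H3_perm 2 6 = 7" "H3_perm 2 7 = 6"
  "H3_perm 3 1 = 4" "H3_perm 3 2 = 3" "H3_perm 3 3 = 2" "H3_perm 3 4 = 1"
    "H3_perm 3 5 = 5" "H3_perm 3 6 = 7" "H3_perm 3 7 = 6"
  by (simp_all add: H3_perm_def transpose_def)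

lemma H3_perm_permutes: "H3_perm s permutes {1..7}"
  unfolding H3_perm_def by (intro permutes_compose) (auto intro!: permutes_compose permutes_swap_id)

lemma word_eval_H3_perm:
  "word_eval (sym_group 7) H3_perm (map (\<lambda>s. (s, True)) w) = foldr H3_perm w"
  by (induction w) (auto simp: word_eval_def sym_group_def fun_eq_iff)

lemma permutes_eq_idI:
  assumes "p permutes {1..7::nat}" "\<forall>i\<in>{1, 2, 3, 4, 5, 6, 7}. p i = i"
  shows "p = id"
proof
  have "{1..7::nat} = {1, 2, 3, 4, 5, 6, 7}" by auto
  then show "p i = id i" for i
    using assms permutes_not_in[OF assms(1)] by (cases "i \<in> {1..7}") auto
qed

lemma foldr_H3_perm_permutes: "foldr H3_perm w permutes {1..7}"
proof (induction w)
  case Nil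
  show ?case using permutes_id by (simp add: id_def)
next
  case (Cons s w)
  then show ?case using permutes_compose[OF Cons H3_perm_permutes[of s]] by (simp add: comp_def)
qed

lemma H3_perm_relator:
  assumes "s \<in> {1, 2, 3}" "t \<in> {1, 2, 3}" "H3_matrix s t = enat m"
  shows "foldr H3_perm (concat (replicate m [s, t])) = id"
proof (rule permutes_eq_idI[OF foldr_H3_perm_permutes])
  have "(s, t, m) \<in> {(1, 1, 1), (2, 2, 1), (3, 3, 1), (1, 2, 5), (2, 1, 5), (2, 3, 3), (3, 2, 3),
      (1, 3, 2), (3, 1, 2)}"
    using assms by (elim insertE emptyE)
      (simp_all add: H3_matrix_def one_enat_def numeral_eq_enat doubleton_eq_iff)
  moreover have "replicate 1 x = [x]" "replicate 2 x = [x, x]" "replicate 3 x = [x, x, x]"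
    "replicate 5 x = [x, x, x, x, x]" for x :: "nat list"
    by (simp_all add: eval_nat_numeral)
  ultimately show "\<forall>i\<in>{1, 2, 3, 4, 5, 6, 7}. foldr H3_perm (concat (replicate m [s, t])) i = i"
    by (elim insertE emptyE) (simp_all add: H3_perm_values del: One_nat_def)
qed

lemma H3_perm_faithful:
  assumes "t \<in> set coset_words" "d \<in> set dihedral_words" "foldr H3_perm (t @ d) = id"
  shows "t @ d = []"
proof -
  have "\<forall>t\<in>set coset_words. \<forall>d\<in>set dihedral_words.
      t @ d = [] \<or> (\<exists>i\<in>{1, 2, 3, 4, 5, 6, 7}. foldr H3_perm (t @ d) i \<noteq> i)"
    by (simp add: coset_words_def dihedral_words_def H3_perm_values del: One_nat_def)
  then have "t @ d = [] \<or> (\<exists>i\<in>{1, 2, 3, 4, 5, 6, 7}. foldr H3_perm (t @ d) i \<noteq> i)"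
    using assms(1,2) by blast
  then show ?thesis using assms(3) by simp
qed

lemma carrier_W_H3: "carrier W_H3 = H3_elem ` {w. set w \<subseteq> {1, 2, 3}}"
proof -
  have "\<exists>v. set v \<subseteq> {1, 2, 3} \<and>
      pres_class {1, 2, 3} (coxeter_relators {1, 2, 3} H3_matrix) w = H3_elem v"
    if "w \<in> words {1, 2, 3}" for w
    using that
  proof (induction w)
    case Nil
    show ?case by (intro exI[of _ "[]"]) (simp add: H3_elem_def)
  next
    case (Cons l w)
    let ?S = "{1, 2, 3::nat}"
    let ?R = "coxeter_relators ?S H3_matrix"
    obtain s e where l: "l = (s, e)" by force
    have s: "s \<in> ?S" and w: "w \<in> words ?S" using Cons.prems l by (auto simp: words_def)
    then obtain v where v: "set v \<subseteq> ?S" "pres_class ?S ?R w = H3_elem v"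
      using Cons.IH by auto
    then have wv: "pres_eq ?S ?R w (map (\<lambda>s. (s, True)) v)"
      using pres_class_eq_iff[OF w] by (simp add: H3_elem_def)
    \<comment> \<open>The formal inverse of a generator is the generator itself, by cancelling in \<open>s s s\<^sup>-\<^sup>1\<close>.\<close>
    have "pres_eq ?S ?R [(s, e)] [(s, True)]"
    proof (cases e)
      case True
      then show ?thesis using s by (auto simp: words_def intro: pres_eq.refl)
    next
      case False
      have "pres_eq ?S ?R ([(s, True)] @ [(s, True), (s, False)] @ []) ([(s, True)] @ [])"
        using pres_eq.cancel[of "[(s, True)]" ?S "[]" s ?R True] s by (auto simp: words_def)
      moreover have "[(s, True), (s, True)] \<in> ?R"
      proof -
        have "H3_matrix s s = enat 1" by (simp add: H3_matrix_def one_enat_def)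
        moreover have "[(s, True), (s, True)] = concat (replicate 1 [(s, True), (s, True)])" by simp
        ultimately show ?thesis using s unfolding coxeter_relators_def by blast
      qed
      then have "pres_eq ?S ?R ([] @ [(s, True), (s, True)] @ [(s, False)]) ([] @ [(s, False)])"
        using s by (intro pres_eq.relator) (auto simp: words_def)
      ultimately show ?thesis
        using False by simp (blast intro: pres_eq.sym pres_eq.trans)
    qed
    from pres_eq_append[OF this wv]
    have "pres_eq ?S ?R (l # w) (map (\<lambda>s. (s, True)) (s # v))" by (simp add: l)
    then have "pres_class ?S ?R (l # w) = H3_elem (s # v)"
      unfolding H3_elem_def using pres_class_eq_iff[OF Cons.prems] by blast
    then show ?case using s v(1) by (intro exI[of _ "s # v"]) auto
  qed
  moreover have "map (\<lambda>s. (s, True)) v \<in> words {1, 2, 3}" if "set v \<subseteq> {1, 2, 3}" for v :: "nat list"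
    using that by (auto simp: words_def)
  ultimately show ?thesis
    unfolding W_H3_def coxeter_group_def carrier_presented_group
    by (auto simp: image_iff H3_elem_def)
qed

lemma H3_embedding:
  obtains \<psi> where "\<psi> \<in> mon W_H3 (sym_group 7)"
    and "\<And>w. set w \<subseteq> {1, 2, 3} \<Longrightarrow> \<psi> (H3_elem w) = foldr H3_perm w"
proof -
  interpret S: group "sym_group 7" by (rule sym_group_is_group)
  have f: "H3_perm \<in> {1, 2, 3} \<rightarrow> carrier (sym_group 7)"
    using H3_perm_permutes by (auto simp: sym_group_carrier)
  have R: "word_eval (sym_group 7) H3_perm r = \<one>\<^bsub>sym_group 7\<^esub>"
    if mem: "r \<in> coxeter_relators {1, 2, 3} H3_matrix" for r
  proof -
    obtain s t m where r: "s \<in> {1, 2, 3}" "t \<in> {1, 2, 3}" "H3_matrix s t = enat m"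
      "r = concat (replicate m [(s, True), (t, True)])"
      using mem unfolding coxeter_relators_def by blast
    have "r = map (\<lambda>s. (s, True)) (concat (replicate m [s, t]))"
      unfolding r(4) by (simp add: map_concat)
    then show ?thesis
      using word_eval_H3_perm H3_perm_relator[OF r(1-3)] by (simp add: sym_group_one)
  qed
  obtain \<psi> where hom: "\<psi> \<in> hom W_H3 (sym_group 7)"
    and \<psi>: "\<And>w. w \<in> words {1, 2, 3} \<Longrightarrow>
      \<psi> (pres_class {1, 2, 3} (coxeter_relators {1, 2, 3} H3_matrix) w) =
      word_eval (sym_group 7) H3_perm w"
    using S.presented_group_hom[OF f R] unfolding W_H3_def coxeter_group_def by blast
  have val: "\<psi> (H3_elem w) = foldr H3_perm w" if "set w \<subseteq> {1, 2, 3}" for w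
  proof -
    have "map (\<lambda>s. (s, True)) w \<in> words {1, 2, 3}" using that by (auto simp: words_def)
    then show ?thesis using \<psi> by (simp add: H3_elem_def word_eval_H3_perm)
  qed
  interpret \<psi>: group_hom W_H3 "sym_group 7" \<psi>
    using hom group_presented_group S.group_axioms
    by (simp add: group_hom_def group_hom_axioms_def W_H3_def coxeter_group_def)
  have "x = \<one>\<^bsub>W_H3\<^esub>" if x: "x \<in> carrier W_H3" "\<psi> x = \<one>\<^bsub>sym_group 7\<^esub>" for x
  proof -
    obtain w where w: "set w \<subseteq> {1, 2, 3}" "x = H3_elem w"
      using x(1) carrier_W_H3 by auto
    obtain t d where td: "t \<in> set coset_words" "d \<in> set dihedral_words" "x = H3_elem (t @ d)"
      using H3_normal_form[OF w(1)] w(2) by blast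
    have "set (t @ d) \<subseteq> {1, 2, 3}"
      using w td(3) H3_elem_eq_letters by metis
    then have "foldr H3_perm (t @ d) = id"
      using x(2) td(3) val by (simp add: sym_group_one)
    then have "x = H3_elem []"
      using H3_perm_faithful[OF td(1,2)] td(3) by simp
    then show ?thesis
      by (simp add: H3_elem_def W_H3_def coxeter_group_def one_presented_group)
  qed
  then have "\<psi> \<in> mon W_H3 (sym_group 7)"
    using hom \<psi>.inj_on_one_iff by (auto simp: mon_def)
  then show thesis using that val by blast
qed

section \<open>The minimal degree\<close>

theorem proposition4p2:
  shows "min_perm_degree W_H3 = 7"
proof -
  interpret W: group W_H3
    using group_presented_group by (simp add: W_H3_def coxeter_group_def)
  obtain \<psi> where \<psi>: "\<psi> \<in> mon W_H3 (sym_group 7)"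
    and val: "\<And>w. set w \<subseteq> {1, 2, 3} \<Longrightarrow> \<psi> (H3_elem w) = foldr H3_perm w"
    using H3_embedding by blast
  define c where "c = H3_elem [1, 2, 3]"
  have c: "c \<in> carrier W_H3" using carrier_W_H3 by (auto simp: c_def)
  have pow: "\<phi> (c [^]\<^bsub>W_H3\<^esub> n) = \<phi> c ^^ n" if "\<phi> \<in> mon W_H3 (sym_group m)" for \<phi> m and n :: nat
    using that hom_nat_pow[of \<phi> W_H3 "sym_group m" c n] c W.group_axioms sym_group_is_group
    by (simp add: mon_def sym_group_pow)
  have pow_one: "\<phi> c ^^ n = id \<longleftrightarrow> c [^]\<^bsub>W_H3\<^esub> n = \<one>\<^bsub>W_H3\<^esub>"
    if "\<phi> \<in> mon W_H3 (sym_group m)" for \<phi> m and n :: nat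
  proof -
    have "\<phi> \<in> hom W_H3 (sym_group m)" "inj_on \<phi> (carrier W_H3)"
      using that by (auto simp: mon_def)
    moreover have "\<phi> \<one>\<^bsub>W_H3\<^esub> = id"
      using hom_one[OF calculation(1) W.group_axioms sym_group_is_group] by (simp add: sym_group_one)
    ultimately show ?thesis
      using pow[OF that, of n] c W.nat_pow_closed W.one_closed by (metis inj_onD)
  qed
  have \<psi>c: "\<psi> c = foldr H3_perm [1, 2, 3]" unfolding c_def by (rule val) simp
  have funpow_2_5: "(p ^^ 2) i = p (p i)" "(p ^^ 5) i = p (p (p (p (p i))))"
    for p :: "nat \<Rightarrow> nat" and i
    by (simp_all add: eval_nat_numeral)
  have c10: "c [^]\<^bsub>W_H3\<^esub> (2 * 5 :: nat) = \<one>\<^bsub>W_H3\<^esub>"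
  proof -
    have "foldr H3_perm [1, 2, 3] ^^ (2 * 5) = id"
    proof (rule permutes_eq_idI[OF permutes_funpow[OF foldr_H3_perm_permutes]])
      show "\<forall>i\<in>{1, 2, 3, 4, 5, 6, 7}. (foldr H3_perm [1, 2, 3] ^^ (2 * 5)) i = i"
        unfolding funpow_mult[symmetric] funpow_2_5
        by (simp add: H3_perm_values del: One_nat_def)
    qed
    then show ?thesis using pow_one[OF \<psi>] \<psi>c by metis
  qed
  (* The Coxeter element acts as a 5-cycle on {1..5} and as a transposition on {6, 7}. *)
  have "(foldr H3_perm [1, 2, 3] ^^ 2) 1 \<noteq> 1" "(foldr H3_perm [1, 2, 3] ^^ 5) 6 \<noteq> 6"
    by (simp_all add: funpow_2_5 H3_perm_values del: One_nat_def)
  then have c2: "c [^]\<^bsub>W_H3\<^esub> (2::nat) \<noteq> \<one>\<^bsub>W_H3\<^esub>" and c5: "c [^]\<^bsub>W_H3\<^esub> (5::nat) \<noteq> \<one>\<^bsub>W_H3\<^esub>"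
    using pow_one[OF \<psi>] \<psi>c by (metis id_apply)+
  have "7 \<le> m" if \<phi>: "\<phi> \<in> mon W_H3 (sym_group m)" for \<phi> m
  proof (rule ccontr)
    assume "\<not> 7 \<le> m"
    moreover have "\<phi> c permutes {1..m}"
      using \<phi> c by (auto simp: mon_def hom_def sym_group_def)
    moreover have "\<phi> c ^^ (2 * 5) = id"
      using pow_one[OF \<phi>] c10 by blast
    ultimately have "\<phi> c ^^ 2 = id \<or> \<phi> c ^^ 5 = id"
      by (intro funpow_prime_mult_eq_id) auto
    then show False using pow_one[OF \<phi>] c2 c5 by blast
  qed
  then show ?thesis
    unfolding min_perm_degree_def using \<psi> by (intro Least_equality) blast+
qed

end
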